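(* Let $n\ge 2$, $\alpha,\beta\in(0,\infty)$, $a=\alpha^{-1}$, $b=\beta^{-1}$, and let $1\le j_1<\dots<j_r\le n-1$. If $j_k\le j_{k+1}-2$ for all $k=1,\dots,r-1$, then \[\mathbb{P}\big(S_{n,\alpha,\beta}(j_1)\neq 0,\dots,S_{n,\alpha,\beta}(j_r)\neq 0\big)=\prod_{k=1}^{r}\frac{1}{n+a+b-r+k-1}.\] Otherwise, $\mathbb{P}\big(S_{n,\alpha,\beta}(j_1)\neq 0,\dots,S_{n,\alpha,\beta}(j_r)\neq 0\big)=0$. Here $S_{n,\alpha,\beta}(j)\neq0$ means that the box is non-empty.
   Context: A staircase tableau of size $n$ is a Young diagram of shape $(n,n-1,\dots,1)$ (row $i$ has boxes $(i,j)$, $1\le j\le n-i+1$; rows numbered top to bottom, columns left to right) whose boxes are empty or contain a symbol, such that: all boxes in the same column and above an $\alpha$ are empty; all boxes in the same row and to the left of a $\beta$ are empty; every box $(i,j)$ with $i+j=n+1$ (main diagonal) contains a symbol. An $\alpha/\beta$-staircase tableau uses only the symbols $\alpha,\beta$; its weight is $\alpha^{N_\alpha}\beta^{N_\beta}$ ($N_\alpha,N_\beta$ the numbers of $\alpha$'s and $\beta$'s). $S_{n,\alpha,\beta}$ is the random $\alpha/\beta$-staircase tableau of size $n$ with $\mathbb{P}(S_{n,\alpha,\beta}=S)=wt(S)/\sum_{S'}wt(S')$. The second main diagonal consists of the boxes $(n-i,i)$, $i=1,\dots,n-1$, and $S_{n,\alpha,\beta}(i)$ denotes the content of box $(n-i,i)$.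 *)

theory Defs
  imports "HOL-Probability.Probability"
begin

datatype ab_symbol = Alpha | Beta

text \<open>A filling assigns to every pair (row, column) either a symbol or \<open>None\<close> (empty).
  Rows and columns are numbered from 1, as matrix entries. Fillings are \<open>None\<close> outside the
  diagram, so that distinct tableaux are distinct functions.\<close>

type_synonym filling = "nat \<times> nat \<Rightarrow> ab_symbol option"

definition staircase_shape :: "nat \<Rightarrow> (nat \<times> nat) set" where
  "staircase_shape n = {(i, j). 1 \<le> i \<and> i \<le> n \<and> 1 \<le> j \<and> j \<le> n - i + 1}"

definition ab_staircase_tableau :: "nat \<Rightarrow> filling \<Rightarrow> bool" where
  "ab_staircase_tableau n S \<longleftrightarrow>
     (\<forall>p. p \<notin> staircase_shape n \<longrightarrow> S p = None) \<and>
     (\<forall>i j. S (i, j) = Some Alpha \<longrightarrow> (\<forall>i'<i. S (i', j) = None)) \<and>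
     (\<forall>i j. S (i, j) = Some Beta \<longrightarrow> (\<forall>j'<j. S (i, j') = None)) \<and>
     (\<forall>(i, j) \<in> staircase_shape n. i + j = n + 1 \<longrightarrow> S (i, j) \<noteq> None)"

definition ab_tableaux :: "nat \<Rightarrow> filling set" where
  "ab_tableaux n = {S. ab_staircase_tableau n S}"

definition num_symbol :: "ab_symbol \<Rightarrow> filling \<Rightarrow> nat" where
  "num_symbol x S = card {p. S p = Some x}"

definition tableau_wt :: "real \<Rightarrow> real \<Rightarrow> filling \<Rightarrow> real" where
  "tableau_wt \<alpha> \<beta> S = \<alpha> ^ num_symbol Alpha S * \<beta> ^ num_symbol Beta S"

text \<open>The law of the random tableau. For positive \<open>\<alpha>\<close>, \<open>\<beta>\<close> the given function is a probability
  mass function, see \<open>pmf_random_ab_tableau\<close> below.\<close>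

definition random_ab_tableau :: "nat \<Rightarrow> real \<Rightarrow> real \<Rightarrow> filling pmf" where
  "random_ab_tableau n \<alpha> \<beta> = embed_pmf (\<lambda>S.
     if S \<in> ab_tableaux n
     then tableau_wt \<alpha> \<beta> S / (\<Sum>S'\<in>ab_tableaux n. tableau_wt \<alpha> \<beta> S') else 0)"

definition second_diag :: "nat \<Rightarrow> filling \<Rightarrow> nat \<Rightarrow> ab_symbol option" where
  "second_diag n S i = S (n - i, i)"

lemma finite_staircase_shape: "finite (staircase_shape n)"
  by (rule finite_subset[of _ "{..n} \<times> {..n + 1}"]) (auto simp: staircase_shape_def)

lemma finite_ab_tableaux: "finite (ab_tableaux n)"
proof -
  let ?V = "insert None (Some ` {Alpha, Beta})"
  let ?F = "{S :: filling. \<forall>p. (p \<in> staircase_shape n \<longrightarrow> S p \<in> ?V) \<and>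
    (p \<notin> staircase_shape n \<longrightarrow> S p = None)}"
  have V: "x \<in> ?V" for x
  proof (cases x)
    case (Some y)
    then show ?thesis by (cases y) simp_all
  qed simp
  have "ab_tableaux n \<subseteq> ?F"
  proof
    fix S assume "S \<in> ab_tableaux n"
    then have "\<forall>p. p \<notin> staircase_shape n \<longrightarrow> S p = None"
      unfolding ab_tableaux_def ab_staircase_tableau_def mem_Collect_eq by (elim conjE)
    with V show "S \<in> ?F" by blast
  qed
  moreover have "finite ?F"
    by (intro finite_set_of_finite_funs finite_staircase_shape) simp
  ultimately show ?thesis by (rule finite_subset)
qed

lemma ab_tableaux_nonempty: "ab_tableaux n \<noteq> {}"
proof -
  define S :: filling where
    "S = (\<lambda>p. if p \<in> staircase_shape n \<and> fst p + snd p = n + 1 then Some Alpha else None)"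
  have S_None: "S p = None \<longleftrightarrow> \<not> (p \<in> staircase_shape n \<and> fst p + snd p = n + 1)" for p
    by (simp add: S_def)
  have S_Beta: "S p \<noteq> Some Beta" for p
    by (simp add: S_def)
  have S_Alpha: "S p = Some Alpha \<Longrightarrow> fst p + snd p = n + 1" for p
    by (simp add: S_def split: if_splits)
  have "S (i', j) = None" if "S (i, j) = Some Alpha" "i' < i" for i j i'
    using S_Alpha[OF that(1)] that(2) by (simp add: S_None)
  then have "ab_staircase_tableau n S"
    unfolding ab_staircase_tableau_def using S_Beta S_None by auto
  then show ?thesis
    by (auto simp: ab_tableaux_def)
qed

lemma tableau_wt_pos: "\<alpha> > 0 \<Longrightarrow> \<beta> > 0 \<Longrightarrow> tableau_wt \<alpha> \<beta> S > 0"
  by (simp add: tableau_wt_def)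

lemma pmf_random_ab_tableau:
  assumes "\<alpha> > 0" "\<beta> > 0"
  shows "pmf (random_ab_tableau n \<alpha> \<beta>) S =
    (if S \<in> ab_tableaux n
     then tableau_wt \<alpha> \<beta> S / (\<Sum>S'\<in>ab_tableaux n. tableau_wt \<alpha> \<beta> S') else 0)"
proof -
  let ?Z = "\<Sum>S'\<in>ab_tableaux n. tableau_wt \<alpha> \<beta> S'"
  let ?f = "\<lambda>S. if S \<in> ab_tableaux n then tableau_wt \<alpha> \<beta> S / ?Z else 0"
  have Z: "?Z > 0"
    by (intro sum_pos finite_ab_tableaux ab_tableaux_nonempty tableau_wt_pos assms)
  have nonneg: "0 \<le> ?f S" for S
    using Z tableau_wt_pos[OF assms, of S] by simp
  have "(\<integral>\<^sup>+S. ennreal (?f S) \<partial>count_space UNIV) = (\<Sum>S\<in>ab_tableaux n. ennreal (?f S))"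
    by (rule nn_integral_count_space') (auto simp: finite_ab_tableaux)
  also have "\<dots> = ennreal (\<Sum>S\<in>ab_tableaux n. ?f S)"
    by (rule sum_ennreal) (rule nonneg)
  also have "(\<Sum>S\<in>ab_tableaux n. ?f S) = 1"
    using Z by (simp add: sum_divide_distrib[symmetric])
  finally have one: "(\<integral>\<^sup>+S. ennreal (?f S) \<partial>count_space UNIV) = 1"
    by (simp only: ennreal_1)
  show ?thesis
    unfolding random_ab_tableau_def by (rule pmf_embed_pmf[OF nonneg one])
qed

end

theory Submission imports Defs begin

text \<open>Let \<open>p + i = n + 1\<close>. If the box \<open>(p, i)\<close> of a tableau of size \<open>n + 1\<close> is non-empty, its diagonal
  neighbours are forced to be \<open>\<alpha>\<close> at \<open>(p, i + 1)\<close> and \<open>\<beta>\<close> at \<open>(p + 1, i)\<close>; hence two adjacent boxes of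
  the second diagonal are never both non-empty, and row \<open>p + 1\<close> and column \<open>i + 1\<close> contain nothing
  else. Deleting this row and column is a bijection onto the tableaux of size \<open>n\<close> that costs the
  factor \<open>\<alpha>\<beta>\<close>. If instead the box is empty, exchanging rows \<open>p\<close>, \<open>p + 1\<close> and columns \<open>i\<close>, \<open>i + 1\<close>
  exchanges the adjacent diagonal symbols \<open>\<beta>\<close>, \<open>\<alpha>\<close>. So moving one step along the diagonal increases the
  total weight of the tableaux with an \<open>\<alpha>\<close> at that place by \<open>\<alpha>\<beta> Z\<^sub>n\<close>, which yields
  \<open>Z\<^bsub>n+1\<^esub> = (\<alpha> + \<beta> + n\<alpha>\<beta>) Z\<^sub>n\<close> for the total weight. Deleting the non-empty boxes one at a time then
  gives the product.\<close>

section \<open>Coordinates of tableaux and forced symbols\<close>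

lemma mem_staircase_shape:
  "(r, c) \<in> staircase_shape n \<longleftrightarrow> 1 \<le> r \<and> 1 \<le> c \<and> r + c \<le> n + 1"
  by (auto simp: staircase_shape_def)

text \<open>Bounding \<open>r + c\<close> avoids truncated subtraction, so that shifts of rows and
  columns become linear arithmetic.\<close>

lemma ab_tableaux_iff:
  "S \<in> ab_tableaux n \<longleftrightarrow>
     (\<forall>r c. r = 0 \<or> c = 0 \<or> n + 1 < r + c \<longrightarrow> S (r, c) = None) \<and>
     (\<forall>r r' c. S (r, c) = Some Alpha \<longrightarrow> r' < r \<longrightarrow> S (r', c) = None) \<and>
     (\<forall>r c c'. S (r, c) = Some Beta \<longrightarrow> c' < c \<longrightarrow> S (r, c') = None) \<and>
     (\<forall>r c. 0 < r \<longrightarrow> 0 < c \<longrightarrow> r + c = n + 1 \<longrightarrow> S (r, c) \<noteq> None)"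
proof -
  have "(\<forall>p. p \<notin> staircase_shape n \<longrightarrow> S p = None) \<longleftrightarrow>
      (\<forall>r c. r = 0 \<or> c = 0 \<or> n + 1 < r + c \<longrightarrow> S (r, c) = None)"
    unfolding split_paired_All mem_staircase_shape not_le de_Morgan_conj less_one by (rule refl)
  moreover have "(\<forall>(r, c)\<in>staircase_shape n. r + c = n + 1 \<longrightarrow> S (r, c) \<noteq> None) \<longleftrightarrow>
      (\<forall>r c. 0 < r \<longrightarrow> 0 < c \<longrightarrow> r + c = n + 1 \<longrightarrow> S (r, c) \<noteq> None)"
    unfolding Ball_def split_paired_All mem_staircase_shape prod.case
    by (intro all_cong1) (auto simp: Suc_le_eq simp del: not_None_eq)
  moreover have "(\<forall>r c. S (r, c) = Some Alpha \<longrightarrow> (\<forall>r'<r. S (r', c) = None)) \<longleftrightarrow>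
      (\<forall>r r' c. S (r, c) = Some Alpha \<longrightarrow> r' < r \<longrightarrow> S (r', c) = None)"
    by fast
  moreover have "(\<forall>r c. S (r, c) = Some Beta \<longrightarrow> (\<forall>c'<c. S (r, c') = None)) \<longleftrightarrow>
      (\<forall>r c c'. S (r, c) = Some Beta \<longrightarrow> c' < c \<longrightarrow> S (r, c') = None)"
    by fast
  ultimately show ?thesis
    unfolding ab_tableaux_def ab_staircase_tableau_def mem_Collect_eq by (simp only:)
qed

context
  fixes n :: nat and S :: filling
  assumes S: "S \<in> ab_tableaux n"
begin

lemma tableau_outside: "r = 0 \<or> c = 0 \<or> n + 1 < r + c \<Longrightarrow> S (r, c) = None"
  by (rule S[unfolded ab_tableaux_iff, THEN conjunct1, rule_format])

lemma tableau_above_Alpha: "S (r, c) = Some Alpha \<Longrightarrow> r' < r \<Longrightarrow> S (r', c) = None"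
  by (rule S[unfolded ab_tableaux_iff, THEN conjunct2, THEN conjunct1, rule_format])

lemma tableau_left_Beta: "S (r, c) = Some Beta \<Longrightarrow> c' < c \<Longrightarrow> S (r, c') = None"
  by (rule S[unfolded ab_tableaux_iff, THEN conjunct2, THEN conjunct2, THEN conjunct1, rule_format])

lemma tableau_diag: "0 < r \<Longrightarrow> 0 < c \<Longrightarrow> r + c = n + 1 \<Longrightarrow> S (r, c) \<noteq> None"
  by (rule S[unfolded ab_tableaux_iff, THEN conjunct2, THEN conjunct2, THEN conjunct2, rule_format])

lemma tableau_diag_Beta:
  "0 < r \<Longrightarrow> 0 < c \<Longrightarrow> r + c = n + 1 \<Longrightarrow> S (r, c) \<noteq> Some Alpha \<longleftrightarrow> S (r, c) = Some Beta"
proof -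
  assume "0 < r" "0 < c" "r + c = n + 1"
  then have "S (r, c) \<noteq> None" by (rule tableau_diag)
  then obtain x where "S (r, c) = Some x" by blast
  then show ?thesis by (cases x) simp_all
qed

lemma tableau_column_Alpha:
  assumes "S (r, c) = Some Alpha" "r + c = n + 1" "r' \<noteq> r"
  shows "S (r', c) = None"
proof (cases "r' < r")
  case True
  then show ?thesis by (rule tableau_above_Alpha[OF assms(1)])
next
  case False
  then show ?thesis using assms(2,3) by (intro tableau_outside) linarith
qed

lemma tableau_row_Beta:
  assumes "S (r, c) = Some Beta" "r + c = n + 1" "c' \<noteq> c"
  shows "S (r, c') = None"
proof (cases "c' < c")
  case True
  then show ?thesis by (rule tableau_left_Beta[OF assms(1)])
next
  case False
  then show ?thesis using assms(2,3) by (intro tableau_outside) linarith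
qed

text \<open>A \<beta> at \<open>(p, Suc i)\<close> or an \<alpha> at \<open>(Suc p, i)\<close> would
  empty \<open>(p, i)\<close>. Both boxes are on the main diagonal, so the other symbol
  remains.\<close>

lemma second_diag_nonempty:
  assumes "p + i = n" "S (p, i) \<noteq> None"
  shows "S (p, Suc i) = Some Alpha" "S (Suc p, i) = Some Beta"
proof -
  have "\<not> (p = 0 \<or> i = 0 \<or> n + 1 < p + i)"
    using assms(2) by (rule contrapos_nn) (rule tableau_outside)
  then have pos: "0 < p" "0 < i"
    by simp_all
  have "S (p, Suc i) \<noteq> Some Beta"
    using assms(2) by (rule contrapos_nn) (rule tableau_left_Beta, assumption, simp)
  then show "S (p, Suc i) = Some Alpha"
    using tableau_diag_Beta[of p "Suc i"] pos assms(1) by force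
  have "S (Suc p, i) \<noteq> Some Alpha"
    using assms(2) by (rule contrapos_nn) (rule tableau_above_Alpha, assumption, simp)
  then show "S (Suc p, i) = Some Beta"
    using tableau_diag_Beta[of "Suc p" i] pos assms(1) by simp
qed

end

lemma finite_symbol_cells: "S \<in> ab_tableaux n \<Longrightarrow> finite {q. S q = Some x}"
proof (rule finite_subset[OF _ finite_staircase_shape[of n]], rule subsetI)
  fix q assume "S \<in> ab_tableaux n" "q \<in> {q. S q = Some x}"
  then have "q \<notin> staircase_shape n \<longrightarrow> S q = None" "S q = Some x"
    unfolding ab_tableaux_def ab_staircase_tableau_def by blast+
  then show "q \<in> staircase_shape n" by auto
qed

section \<open>Total weights of events\<close>

definition wt_sum :: "real \<Rightarrow> real \<Rightarrow> nat \<Rightarrow> (filling \<Rightarrow> bool) \<Rightarrow> real" where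
  "wt_sum \<alpha> \<beta> n P = (\<Sum>S | S \<in> ab_tableaux n \<and> P S. tableau_wt \<alpha> \<beta> S)"

lemma wt_sum_split: "wt_sum \<alpha> \<beta> n P = wt_sum \<alpha> \<beta> n (\<lambda>S. P S \<and> Q S) + wt_sum \<alpha> \<beta> n (\<lambda>S. P S \<and> \<not> Q S)"
  unfolding wt_sum_def
  by (subst sum.union_disjoint[symmetric])
     (auto intro: sum.cong finite_subset[OF _ finite_ab_tableaux[of n]])

lemma wt_sum_cong: "(\<And>S. S \<in> ab_tableaux n \<Longrightarrow> P S = Q S) \<Longrightarrow> wt_sum \<alpha> \<beta> n P = wt_sum \<alpha> \<beta> n Q"
  unfolding wt_sum_def by (rule sum.cong) auto

subsection \<open>Deleting a row and a column\<close>

text \<open>\<open>skip k\<close> enumerates the numbers other than \<open>Suc k\<close> in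
  increasing order; \<open>unskip k\<close> is its inverse away from \<open>Suc k\<close>.\<close>

definition skip :: "nat \<Rightarrow> nat \<Rightarrow> nat" where
  "skip k x = (if x \<le> k then x else Suc x)"

definition unskip :: "nat \<Rightarrow> nat \<Rightarrow> nat" where
  "unskip k x = (if x \<le> k then x else x - 1)"

lemma skip_neq: "skip k x \<noteq> Suc k"
  by (simp add: skip_def)

lemma unskip_skip: "unskip k (skip k x) = x"
  by (simp add: skip_def unskip_def)

lemma skip_unskip: "x \<noteq> Suc k \<Longrightarrow> skip k (unskip k x) = x"
  by (auto simp: skip_def unskip_def)

text \<open>The box \<open>(p, i)\<close> stays in place. With \<open>p + i = Suc n\<close> it
  passes from the second diagonal of size \<open>Suc n\<close> to the main diagonal of size
  \<open>n\<close>, where a symbol is required.\<close>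

definition delete_cross :: "nat \<Rightarrow> nat \<Rightarrow> filling \<Rightarrow> filling" where
  "delete_cross p i S = (\<lambda>(r, c). S (skip p r, skip i c))"

definition insert_cross :: "nat \<Rightarrow> nat \<Rightarrow> filling \<Rightarrow> filling" where
  "insert_cross p i S = (\<lambda>(r, c).
     if r = Suc p then (if c = i \<and> 0 < i then Some Beta else None)
     else if c = Suc i then (if r = p \<and> 0 < p then Some Alpha else None)
     else S (unskip p r, unskip i c))"

text \<open>The degenerate cases \<open>p = 0\<close> and \<open>i = 0\<close> are allowed: then only a row, respectively only a
  column, of the diagram is deleted, because the other line lies outside of it.\<close>

definition full_cross :: "nat \<Rightarrow> nat \<Rightarrow> filling \<Rightarrow> bool" where
  "full_cross p i S \<longleftrightarrow> (0 < p \<longrightarrow> S (p, Suc i) = Some Alpha) \<and>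
     (0 < i \<longrightarrow> S (Suc p, i) = Some Beta) \<and> (0 < p \<longrightarrow> 0 < i \<longrightarrow> S (p, i) \<noteq> None)"

lemma delete_insert_cross: "delete_cross p i (insert_cross p i S) = S"
  by (auto simp: delete_cross_def insert_cross_def skip_neq unskip_skip)

text \<open>A diagonal \<beta> empties the rest of its row and a diagonal \<alpha> the rest of its
  column, so the deleted lines carry no further information.\<close>

lemma insert_delete_cross:
  assumes "S \<in> ab_tableaux (Suc n)" "p + i = Suc n" "full_cross p i S"
  shows "insert_cross p i (delete_cross p i S) = S"
proof (rule ext)
  fix q :: "nat \<times> nat"
  obtain r c where q: "q = (r, c)" by (cases q)
  have "S (Suc p, c) = (if c = i \<and> 0 < i then Some Beta else None)"
  proof (cases "i = 0")
    case True
    then have "S (Suc p, c) = None"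
      using assms(2) by (intro tableau_outside[OF assms(1)]) linarith
    then show ?thesis using True by simp
  next
    case False
    then have "S (Suc p, i) = Some Beta"
      using assms(3) by (simp add: full_cross_def)
    then show ?thesis
      using False tableau_row_Beta[OF assms(1), of "Suc p" i c] assms(2) by auto
  qed
  moreover have "S (r, Suc i) = (if r = p \<and> 0 < p then Some Alpha else None)"
  proof (cases "p = 0")
    case True
    then have "S (r, Suc i) = None"
      using assms(2) by (intro tableau_outside[OF assms(1)]) linarith
    then show ?thesis using True by simp
  next
    case False
    then have "S (p, Suc i) = Some Alpha"
      using assms(3) by (simp add: full_cross_def)
    then show ?thesis
      using False tableau_column_Alpha[OF assms(1), of p "Suc i" r] assms(2) by auto
  qed
  ultimately show "insert_cross p i (delete_cross p i S) q = S q"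
    by (auto simp: q insert_cross_def delete_cross_def skip_unskip)
qed

lemma delete_cross_tableau:
  assumes S: "S \<in> ab_tableaux (Suc n)" "p + i = Suc n" "full_cross p i S"
  shows "delete_cross p i S \<in> ab_tableaux n"
  unfolding ab_tableaux_iff
proof (intro conjI allI impI)
  fix r c assume "r = 0 \<or> c = 0 \<or> n + 1 < r + c"
  then show "delete_cross p i S (r, c) = None"
    using S(2) by (auto simp: delete_cross_def skip_def intro!: tableau_outside[OF S(1)])
next
  fix r r' c assume "delete_cross p i S (r, c) = Some Alpha" "r' < r"
  then show "delete_cross p i S (r', c) = None"
    by (auto simp: delete_cross_def skip_def elim!: tableau_above_Alpha[OF S(1)] split: if_splits)
next
  fix r c c' assume "delete_cross p i S (r, c) = Some Beta" "c' < c"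
  then show "delete_cross p i S (r, c') = None"
    by (auto simp: delete_cross_def skip_def elim!: tableau_left_Beta[OF S(1)] split: if_splits)
next
  fix r c assume rc: "0 < r" "0 < c" "r + c = n + 1"
  show "delete_cross p i S (r, c) \<noteq> None"
  \<comment> \<open>Only at \<open>(p, i)\<close> is neither coordinate shifted; at any other
    diagonal box exactly one is, which leads to the diagonal of size \<open>Suc n\<close>.\<close>
  proof (cases "r = p")
    case True
    moreover from this have "c = i" using rc S(2) by simp
    ultimately show ?thesis
      using rc S(3) by (simp add: delete_cross_def skip_def full_cross_def)
  next
    case False
    then have "skip p r + skip i c = Suc n + 1"
      using rc S(2) by (auto simp: skip_def)
    moreover have "0 < skip p r" "0 < skip i c"
      using rc by (auto simp: skip_def)
    ultimately show ?thesis
      using tableau_diag[OF S(1)] by (auto simp: delete_cross_def)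
  qed
qed

text \<open>Each inserted symbol is alone in the line that it must clear, and \<open>unskip\<close>
  is strictly increasing off the inserted lines. This leaves only conflicts of an old symbol with an
  inserted one.\<close>

lemma insert_cross_tableau:
  assumes S: "S \<in> ab_tableaux n" "p + i = Suc n"
  shows "insert_cross p i S \<in> ab_tableaux (Suc n)"
  unfolding ab_tableaux_iff
proof (intro conjI allI impI)
  fix r c assume "r = 0 \<or> c = 0 \<or> Suc n + 1 < r + c"
  then show "insert_cross p i S (r, c) = None"
    using S(2) by (auto simp: insert_cross_def unskip_def intro!: tableau_outside[OF S(1)])
next
  fix r r' c assume *: "insert_cross p i S (r, c) = Some Alpha" "r' < r"
  show "insert_cross p i S (r', c) = None"
  proof (cases "r = Suc p \<or> c = Suc i")
    case True
    then show ?thesis using * by (auto simp: insert_cross_def split: if_splits)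
  next
    case False
    then have A: "S (unskip p r, unskip i c) = Some Alpha"
      using *(1) by (simp add: insert_cross_def)
    show ?thesis
    proof (cases "r' = Suc p")
      case True
      \<comment> \<open>An old \<alpha> below the inserted \<beta> would come from a row below
        \<open>p\<close> in column \<open>i\<close>, hence from outside the diagram of
        \<open>S\<close>.\<close>
      have "c \<noteq> i"
      proof
        assume "c = i"
        then have "n + 1 < unskip p r + unskip i c"
          using True *(2) S(2) by (simp add: unskip_def)
        then show False using A tableau_outside[OF S(1)] by simp
      qed
      then show ?thesis using True by (simp add: insert_cross_def)
    next
      case r': False
      then have "unskip p r' < unskip p r"
        using *(2) False by (auto simp: unskip_def)
      then show ?thesis
        using tableau_above_Alpha[OF S(1) A] False r' by (simp add: insert_cross_def)
    qed
  qed
next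
  fix r c c' assume *: "insert_cross p i S (r, c) = Some Beta" "c' < c"
  show "insert_cross p i S (r, c') = None"
  proof (cases "r = Suc p \<or> c = Suc i")
    case True
    then show ?thesis using * by (auto simp: insert_cross_def split: if_splits)
  next
    case False
    then have B: "S (unskip p r, unskip i c) = Some Beta"
      using *(1) by (simp add: insert_cross_def)
    show ?thesis
    proof (cases "c' = Suc i")
      case True
      have "r \<noteq> p"
      proof
        assume "r = p"
        then have "n + 1 < unskip p r + unskip i c"
          using True *(2) S(2) by (simp add: unskip_def)
        then show False using B tableau_outside[OF S(1)] by simp
      qed
      then show ?thesis using True False by (simp add: insert_cross_def)
    next
      case c': False
      then have "unskip i c' < unskip i c"
        using *(2) False by (auto simp: unskip_def)
      then show ?thesis
        using tableau_left_Beta[OF S(1) B] False c' by (simp add: insert_cross_def)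
    qed
  qed
next
  fix r c assume rc: "0 < r" "0 < c" "r + c = Suc n + 1"
  show "insert_cross p i S (r, c) \<noteq> None"
  proof (cases "r = Suc p \<or> c = Suc i")
    case True
    then show ?thesis using rc S(2) by (auto simp: insert_cross_def)
  next
    case False
    then have "unskip p r + unskip i c = n + 1" "0 < unskip p r" "0 < unskip i c"
      using rc S(2) by (auto simp: unskip_def)
    then have "S (unskip p r, unskip i c) \<noteq> None"
      using tableau_diag[OF S(1)] by blast
    then show ?thesis using False by (simp add: insert_cross_def)
  qed
qed

lemma full_cross_insert:
  assumes "S \<in> ab_tableaux n" "p + i = Suc n"
  shows "full_cross p i (insert_cross p i S)"
  using tableau_diag[OF assms(1), of p i] assms(2)
  by (auto simp: full_cross_def insert_cross_def unskip_def)

text \<open>\<open>skip\<close> in both coordinates embeds the old boxes, and the inserted symbols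
  lie outside its image.\<close>

lemma tableau_wt_insert_cross:
  assumes "S \<in> ab_tableaux n"
  shows "tableau_wt \<alpha> \<beta> (insert_cross p i S) =
    (if 0 < p then \<alpha> else 1) * (if 0 < i then \<beta> else 1) * tableau_wt \<alpha> \<beta> S"
proof -
  let ?f = "map_prod (skip p) (skip i)"
  have inj: "inj ?f"
    by (intro prod.inj_map injI) (metis unskip_skip)+
  define X where "X x = ?f ` {q. S q = Some x}" for x
  have cells: "{q. insert_cross p i S q = Some x} = X x \<union>
      (case x of Alpha \<Rightarrow> if 0 < p then {(p, Suc i)} else {} |
        Beta \<Rightarrow> if 0 < i then {(Suc p, i)} else {})" (is "?L = ?R") for x
  proof (rule set_eqI)
    fix q :: "nat \<times> nat"
    obtain r c where q: "q = (r, c)" by (cases q)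
    have "q \<in> X x \<longleftrightarrow>
        r \<noteq> Suc p \<and> c \<noteq> Suc i \<and> S (unskip p r, unskip i c) = Some x"
    proof
      assume "r \<noteq> Suc p \<and> c \<noteq> Suc i \<and> S (unskip p r, unskip i c) = Some x"
      then show "q \<in> X x"
        unfolding X_def by (intro image_eqI[of _ _ "(unskip p r, unskip i c)"]) (auto simp: q skip_unskip)
    qed (auto simp: X_def q skip_neq unskip_skip)
    then show "q \<in> ?L \<longleftrightarrow> q \<in> ?R"
      by (cases x) (auto simp: q insert_cross_def)
  qed
  have fin: "finite (X x)" for x
    using finite_symbol_cells[OF assms] by (simp add: X_def)
  have card: "card (X x) = num_symbol x S" for x
    unfolding num_symbol_def X_def by (rule card_image) (rule inj_on_subset[OF inj], simp)
  have notin: "(p, Suc i) \<notin> X x" "(Suc p, i) \<notin> X x" for x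
    unfolding X_def using skip_neq by (fastforce simp: eq_commute)+
  have "num_symbol Alpha (insert_cross p i S) = num_symbol Alpha S + (if 0 < p then 1 else 0)"
    "num_symbol Beta (insert_cross p i S) = num_symbol Beta S + (if 0 < i then 1 else 0)"
    unfolding num_symbol_def[of _ "insert_cross p i S"] cells
    using fin notin by (simp_all add: card)
  then show ?thesis
    by (simp add: tableau_wt_def)
qed

text \<open>Insertion and deletion are mutually inverse. Carrying \<open>P\<close> along lets the
  identity serve both for the partition function and for deleting boxes one at a time.\<close>

lemma wt_sum_full_cross:
  assumes "p + i = Suc n"
  shows "wt_sum \<alpha> \<beta> (Suc n) (\<lambda>S. full_cross p i S \<and> P (delete_cross p i S)) =
    (if 0 < p then \<alpha> else 1) * (if 0 < i then \<beta> else 1) * wt_sum \<alpha> \<beta> n P"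
  unfolding wt_sum_def sum_distrib_left
proof (rule sum.reindex_bij_witness[of _ "insert_cross p i" "delete_cross p i"], goal_cases)
  case (5 S)
  then show ?case
    using tableau_wt_insert_cross[OF delete_cross_tableau[OF _ assms], of S \<alpha> \<beta> p i]
    by (simp add: insert_delete_cross[OF _ assms])
qed (use assms in \<open>simp_all add: insert_delete_cross[OF _ assms] delete_insert_cross
       delete_cross_tableau insert_cross_tableau full_cross_insert[OF _ assms]\<close>)

subsection \<open>Exchanging adjacent diagonal symbols\<close>

abbreviation transpose_Suc :: "nat \<Rightarrow> nat \<Rightarrow> nat" where
  "transpose_Suc k \<equiv> Transposition.transpose k (Suc k)"

definition swap_cross :: "nat \<Rightarrow> nat \<Rightarrow> filling \<Rightarrow> filling" where
  "swap_cross p i S = (\<lambda>(r, c). S (transpose_Suc p r, transpose_Suc i c))"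

lemma swap_cross_swap_cross: "swap_cross p i (swap_cross p i S) = S"
  by (auto simp: swap_cross_def)

lemma tableau_wt_swap_cross: "tableau_wt \<alpha> \<beta> (swap_cross p i S) = tableau_wt \<alpha> \<beta> S"
proof -
  let ?f = "map_prod (transpose_Suc p) (transpose_Suc i)"
  have "num_symbol x (swap_cross p i S) = num_symbol x S" for x
    unfolding num_symbol_def
    by (rule bij_betw_same_card[of ?f], rule bij_betwI[of _ _ _ ?f])
       (auto simp: swap_cross_def)
  then show ?thesis by (simp add: tableau_wt_def)
qed

lemma swap_cross_tableau:
  assumes S: "S \<in> ab_tableaux n" and pi: "p + i = n" "0 < p" "0 < i"
    and corner: "S (p, i) = None"
    and diag: "S (p, Suc i) = Some Alpha \<and> S (Suc p, i) = Some Beta \<or>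
               S (p, Suc i) = Some Beta \<and> S (Suc p, i) = Some Alpha"
  shows "swap_cross p i S \<in> ab_tableaux n"
  unfolding ab_tableaux_iff
proof (intro conjI allI impI)
  \<comment> \<open>Among the boxes outside the diagram only \<open>(Suc p, Suc i)\<close> takes its
    content from inside, namely from the empty box \<open>(p, i)\<close>.\<close>
  fix r c assume "r = 0 \<or> c = 0 \<or> n + 1 < r + c"
  then show "swap_cross p i S (r, c) = None"
    using pi corner
    by (auto simp: swap_cross_def Transposition.transpose_def intro!: tableau_outside[OF S])
next
  fix r r' c assume *: "swap_cross p i S (r, c) = Some Alpha" "r' < r"
  \<comment> \<open>The order is reversed only for rows \<open>p\<close> and \<open>Suc p\<close>.
    An \<alpha> in row \<open>p\<close> has an empty box beneath it, because one of the two rows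
    holds only its diagonal \<beta> and \<open>(p, i)\<close> is empty.\<close>
  have "S (Suc p, c) = None" if "S (p, c) = Some Alpha" for c
    using diag
  proof
    assume "S (p, Suc i) = Some Alpha \<and> S (Suc p, i) = Some Beta"
    then show ?thesis
      using tableau_row_Beta[OF S, of "Suc p" i c] that corner pi by force
  next
    assume "S (p, Suc i) = Some Beta \<and> S (Suc p, i) = Some Alpha"
    then show ?thesis
      using tableau_row_Beta[OF S, of p "Suc i" c] that pi by force
  qed
  moreover have "transpose_Suc p r' < transpose_Suc p r \<or> r' = p \<and> r = Suc p"
    using *(2) by (auto simp: Transposition.transpose_def)
  ultimately show "swap_cross p i S (r', c) = None"
    using *(1) tableau_above_Alpha[OF S, of "transpose_Suc p r" "transpose_Suc i c" "transpose_Suc p r'"]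
    by (elim disjE) (simp_all add: swap_cross_def)
next
  fix r c c' assume *: "swap_cross p i S (r, c) = Some Beta" "c' < c"
  \<comment> \<open>The mirror image: one of the columns \<open>i\<close>, \<open>Suc i\<close>
    holds only its diagonal \<alpha>.\<close>
  have "S (r, Suc i) = None" if "S (r, i) = Some Beta" for r
    using diag
  proof
    assume "S (p, Suc i) = Some Alpha \<and> S (Suc p, i) = Some Beta"
    then show ?thesis
      using tableau_column_Alpha[OF S, of p "Suc i" r] that corner pi by force
  next
    assume "S (p, Suc i) = Some Beta \<and> S (Suc p, i) = Some Alpha"
    then show ?thesis
      using tableau_column_Alpha[OF S, of "Suc p" i r] that pi by force
  qed
  moreover have "transpose_Suc i c' < transpose_Suc i c \<or> c' = i \<and> c = Suc i"
    using *(2) by (auto simp: Transposition.transpose_def)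
  ultimately show "swap_cross p i S (r, c') = None"
    using *(1) tableau_left_Beta[OF S, of "transpose_Suc p r" "transpose_Suc i c" "transpose_Suc i c'"]
    by (elim disjE) (simp_all add: swap_cross_def)
next
  fix r c assume rc: "0 < r" "0 < c" "r + c = n + 1"
  consider "r = p" | "r = Suc p" | "r \<noteq> p" "r \<noteq> Suc p" by blast
  then show "swap_cross p i S (r, c) \<noteq> None"
  proof cases
    case 3
    then have "c \<noteq> i" "c \<noteq> Suc i" using rc pi by auto
    then show ?thesis
      using 3 rc tableau_diag[OF S] by (simp add: swap_cross_def)
  next
    case 1
    then have "c = Suc i" using rc pi by simp
    then show ?thesis using 1 diag by (auto simp: swap_cross_def)
  next
    case 2
    then have "c = i" using rc pi by simp
    then show ?thesis using 2 diag by (auto simp: swap_cross_def)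
  qed
qed

text \<open>On the right the \<alpha> at \<open>(Suc p, i)\<close> empties the corner
  \<open>(p, i)\<close> by itself. The tableaux that the condition on the left excludes are those
  with a full cross.\<close>

lemma wt_sum_swap_cross:
  assumes "p + i = n" "0 < p" "0 < i"
  shows "wt_sum \<alpha> \<beta> n (\<lambda>S. S (p, Suc i) = Some Alpha \<and> S (Suc p, i) = Some Beta \<and> S (p, i) = None) =
    wt_sum \<alpha> \<beta> n (\<lambda>S. S (p, Suc i) = Some Beta \<and> S (Suc p, i) = Some Alpha)"
  unfolding wt_sum_def
proof (rule sum.reindex_bij_witness[of _ "swap_cross p i" "swap_cross p i"], goal_cases)
  case (2 S)
  then show ?case
    using swap_cross_tableau[OF _ assms] by (auto simp: swap_cross_def)
next
  case (4 S)
  then have "S (p, i) = None" "S (Suc p, Suc i) = None"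
    using tableau_above_Alpha[of S n "Suc p" i p] tableau_outside[of S n "Suc p" "Suc i"] assms
    by auto
  then show ?case
    using 4 swap_cross_tableau[OF _ assms] by (auto simp: swap_cross_def)
qed (auto simp: swap_cross_swap_cross tableau_wt_swap_cross)

subsection \<open>The partition function\<close>

text \<open>Induction up the diagonal from its bottom box. There, at \<open>i = 0\<close>, the
  \<alpha> alone is a degenerate full cross and gives \<open>\<alpha> Z\<^sub>n\<close>; each step
  adds \<open>\<alpha>\<beta> Z\<^sub>n\<close>.\<close>

lemma wt_sum_diag_Alpha:
  assumes "p + i = Suc n" "0 < p"
  shows "wt_sum \<alpha> \<beta> (Suc n) (\<lambda>S. S (p, Suc i) = Some Alpha) =
    (\<alpha> + real i * \<alpha> * \<beta>) * wt_sum \<alpha> \<beta> n (\<lambda>_. True)"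
  using assms
proof (induction i arbitrary: p)
  case 0
  have "wt_sum \<alpha> \<beta> (Suc n) (\<lambda>S. S (p, Suc 0) = Some Alpha) =
      wt_sum \<alpha> \<beta> (Suc n) (\<lambda>S. full_cross p 0 S \<and> True)"
    using 0 by (intro wt_sum_cong) (simp add: full_cross_def)
  also have "\<dots> = \<alpha> * wt_sum \<alpha> \<beta> n (\<lambda>_. True)"
    using 0 wt_sum_full_cross[of p 0 n \<alpha> \<beta> "\<lambda>_. True"] by simp
  finally show ?case by simp
next
  case (Suc i)
  let ?W = "wt_sum \<alpha> \<beta> (Suc n)"
  let ?x = "\<lambda>S :: filling. S (p, Suc (Suc i))" and ?y = "\<lambda>S :: filling. S (Suc p, Suc i)"
  let ?z = "\<lambda>S :: filling. S (p, Suc i)"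
  note pi = Suc.prems
  have beta: "?x S \<noteq> Some Alpha \<longleftrightarrow> ?x S = Some Beta" "?y S \<noteq> Some Alpha \<longleftrightarrow> ?y S = Some Beta"
    if "S \<in> ab_tableaux (Suc n)" for S
    using tableau_diag_Beta[OF that] pi by auto
  \<comment> \<open>With \<alpha> at \<open>?x\<close> and \<beta> at \<open>?y\<close>, an empty
    corner \<open>?z\<close> allows the exchange, and a non-empty one gives a full cross.\<close>
  have "?W (\<lambda>S. ?x S = Some Alpha) = ?W (\<lambda>S. ?x S = Some Alpha \<and> ?y S = Some Alpha) +
      ?W (\<lambda>S. ?x S = Some Alpha \<and> ?y S \<noteq> Some Alpha)"
    by (rule wt_sum_split)
  also have "?W (\<lambda>S. ?x S = Some Alpha \<and> ?y S \<noteq> Some Alpha) =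
      ?W (\<lambda>S. ?x S = Some Alpha \<and> ?y S = Some Beta)"
    by (rule wt_sum_cong) (use beta in blast)
  also have "\<dots> = ?W (\<lambda>S. (?x S = Some Alpha \<and> ?y S = Some Beta) \<and> ?z S = None) +
      ?W (\<lambda>S. (?x S = Some Alpha \<and> ?y S = Some Beta) \<and> ?z S \<noteq> None)"
    by (rule wt_sum_split)
  also have "?W (\<lambda>S. (?x S = Some Alpha \<and> ?y S = Some Beta) \<and> ?z S = None) =
      ?W (\<lambda>S. ?x S = Some Beta \<and> ?y S = Some Alpha)"
    using wt_sum_swap_cross[of p "Suc i" "Suc n" \<alpha> \<beta>] pi by (simp add: conj_assoc)
  also have "?W (\<lambda>S. (?x S = Some Alpha \<and> ?y S = Some Beta) \<and> ?z S \<noteq> None) =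
      ?W (\<lambda>S. full_cross p (Suc i) S \<and> True)"
    by (rule wt_sum_cong) (use pi in \<open>simp add: full_cross_def\<close>)
  also have "\<dots> = \<alpha> * \<beta> * wt_sum \<alpha> \<beta> n (\<lambda>_. True)"
    using wt_sum_full_cross[of p "Suc i" n \<alpha> \<beta> "\<lambda>_. True"] pi by simp
  finally have 1: "?W (\<lambda>S. ?x S = Some Alpha) = ?W (\<lambda>S. ?x S = Some Alpha \<and> ?y S = Some Alpha) +
      (?W (\<lambda>S. ?x S = Some Beta \<and> ?y S = Some Alpha) + \<alpha> * \<beta> * wt_sum \<alpha> \<beta> n (\<lambda>_. True))" .
  \<comment> \<open>Splitting the weight for \<open>?y\<close> gives the first two summands again,
    so the difference is the weight of the full crosses.\<close>
  have "?W (\<lambda>S. ?y S = Some Alpha) = ?W (\<lambda>S. ?y S = Some Alpha \<and> ?x S = Some Alpha) +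
      ?W (\<lambda>S. ?y S = Some Alpha \<and> ?x S \<noteq> Some Alpha)"
    by (rule wt_sum_split)
  also have "?W (\<lambda>S. ?y S = Some Alpha \<and> ?x S \<noteq> Some Alpha) =
      ?W (\<lambda>S. ?x S = Some Beta \<and> ?y S = Some Alpha)"
    by (rule wt_sum_cong) (use beta in blast)
  also have "?W (\<lambda>S. ?y S = Some Alpha \<and> ?x S = Some Alpha) =
      ?W (\<lambda>S. ?x S = Some Alpha \<and> ?y S = Some Alpha)"
    by (rule wt_sum_cong) blast
  finally have "?W (\<lambda>S. ?x S = Some Alpha) =
      ?W (\<lambda>S. ?y S = Some Alpha) + \<alpha> * \<beta> * wt_sum \<alpha> \<beta> n (\<lambda>_. True)"
    using 1 by simp
  moreover have "?W (\<lambda>S. ?y S = Some Alpha) = (\<alpha> + real i * \<alpha> * \<beta>) * wt_sum \<alpha> \<beta> n (\<lambda>_. True)"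
    by (rule Suc.IH) (use pi in auto)
  ultimately show ?case by (simp add: algebra_simps)
qed

text \<open>The top diagonal box \<open>(1, Suc n)\<close> decides: an \<alpha> there is
  \<open>n\<close> steps up from the bottom, and a \<beta> leaves nothing else in the first row,
  which is then deleted.\<close>

lemma wt_sum_Suc:
  "wt_sum \<alpha> \<beta> (Suc n) (\<lambda>_. True) = (\<alpha> + \<beta> + real n * \<alpha> * \<beta>) * wt_sum \<alpha> \<beta> n (\<lambda>_. True)"
proof -
  have "wt_sum \<alpha> \<beta> (Suc n) (\<lambda>_. True) =
      wt_sum \<alpha> \<beta> (Suc n) (\<lambda>S. S (1, Suc n) = Some Alpha) +
      wt_sum \<alpha> \<beta> (Suc n) (\<lambda>S. S (1, Suc n) \<noteq> Some Alpha)"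
    using wt_sum_split[of \<alpha> \<beta> "Suc n" "\<lambda>_. True"] by simp
  also have "wt_sum \<alpha> \<beta> (Suc n) (\<lambda>S. S (1, Suc n) \<noteq> Some Alpha) =
      wt_sum \<alpha> \<beta> (Suc n) (\<lambda>S. full_cross 0 (Suc n) S \<and> True)"
    by (rule wt_sum_cong) (simp add: full_cross_def tableau_diag_Beta)
  also have "\<dots> = \<beta> * wt_sum \<alpha> \<beta> n (\<lambda>_. True)"
    using wt_sum_full_cross[of 0 "Suc n" n \<alpha> \<beta> "\<lambda>_. True"] by simp
  also have "wt_sum \<alpha> \<beta> (Suc n) (\<lambda>S. S (1, Suc n) = Some Alpha) =
      (\<alpha> + real n * \<alpha> * \<beta>) * wt_sum \<alpha> \<beta> n (\<lambda>_. True)"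
    by (rule wt_sum_diag_Alpha) simp_all
  finally show ?thesis by (simp add: algebra_simps)
qed

section \<open>Probabilities as ratios of weights\<close>

lemma wt_sum_pos: "\<alpha> > 0 \<Longrightarrow> \<beta> > 0 \<Longrightarrow> wt_sum \<alpha> \<beta> n (\<lambda>_. True) > 0"
  unfolding wt_sum_def
  by (intro sum_pos) (use finite_ab_tableaux ab_tableaux_nonempty tableau_wt_pos in auto)

lemma prob_random_ab_tableau:
  assumes "\<alpha> > 0" "\<beta> > 0"
  shows "measure_pmf.prob (random_ab_tableau n \<alpha> \<beta>) {S. P S} =
    wt_sum \<alpha> \<beta> n P / wt_sum \<alpha> \<beta> n (\<lambda>_. True)"
proof -
  have "set_pmf (random_ab_tableau n \<alpha> \<beta>) \<subseteq> ab_tableaux n"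
    by (auto simp: set_pmf_eq pmf_random_ab_tableau[OF assms])
  then have "measure_pmf.prob (random_ab_tableau n \<alpha> \<beta>) {S. P S} =
      measure_pmf.prob (random_ab_tableau n \<alpha> \<beta>) {S. S \<in> ab_tableaux n \<and> P S}"
    by (intro measure_eq_AE) (auto simp: AE_measure_pmf_iff)
  also have "\<dots> = (\<Sum>S | S \<in> ab_tableaux n \<and> P S. pmf (random_ab_tableau n \<alpha> \<beta>) S)"
    by (rule measure_measure_pmf_finite) (simp add: finite_ab_tableaux)
  also have "\<dots> = wt_sum \<alpha> \<beta> n P / wt_sum \<alpha> \<beta> n (\<lambda>_. True)"
    by (simp add: wt_sum_def sum_divide_distrib pmf_random_ab_tableau[OF assms])
  finally show ?thesis .
qed

section \<open>Deleting boxes of the second diagonal\<close>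

text \<open>The cross at the rightmost chosen box is deleted. The other boxes lie below and to the
  left; they keep their columns and move up one row, onto the second diagonal of size
  \<open>n\<close>.\<close>

lemma wt_sum_second_diag:
  assumes "\<forall>k\<in>{1..Suc r}. 1 \<le> j k \<and> j k \<le> n"
    and "\<forall>k\<in>{1..r}. j k + 2 \<le> j (Suc r)"
  shows "wt_sum \<alpha> \<beta> (Suc n) (\<lambda>S. \<forall>k\<in>{1..Suc r}. second_diag (Suc n) S (j k) \<noteq> None) =
    \<alpha> * \<beta> * wt_sum \<alpha> \<beta> n (\<lambda>S. \<forall>k\<in>{1..r}. second_diag n S (j k) \<noteq> None)"
proof -
  define i where "i = j (Suc r)"
  define p where "p = Suc n - i"
  have pi: "p + i = Suc n" "0 < p" "0 < i"
    using assms(1)[rule_format, of "Suc r"] by (simp_all add: p_def i_def)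
  have "wt_sum \<alpha> \<beta> (Suc n) (\<lambda>S. \<forall>k\<in>{1..Suc r}. second_diag (Suc n) S (j k) \<noteq> None) =
    wt_sum \<alpha> \<beta> (Suc n) (\<lambda>S. full_cross p i S \<and>
      (\<forall>k\<in>{1..r}. second_diag n (delete_cross p i S) (j k) \<noteq> None))"
  proof (rule wt_sum_cong)
    fix S assume S: "S \<in> ab_tableaux (Suc n)"
    have "second_diag (Suc n) S i \<noteq> None \<longleftrightarrow> full_cross p i S"
      using second_diag_nonempty[OF S pi(1)] pi
      by (auto simp: second_diag_def full_cross_def simp flip: p_def)
    moreover have "second_diag n (delete_cross p i S) (j k) = second_diag (Suc n) S (j k)"
      if "k \<in> {1..r}" for k
    proof -
      \<comment> \<open>The gap of two puts row \<open>n - j k\<close> strictly below row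
        \<open>p\<close>, where \<open>skip\<close> adds one.\<close>
      have "j k + 2 \<le> i" using assms(2) that by (simp add: i_def)
      then have "skip p (n - j k) = Suc n - j k" "skip i (j k) = j k"
        using pi by (auto simp: skip_def)
      then show ?thesis by (simp add: second_diag_def delete_cross_def)
    qed
    moreover have "{1..Suc r} = insert (Suc r) {1..r}" by auto
    ultimately show "(\<forall>k\<in>{1..Suc r}. second_diag (Suc n) S (j k) \<noteq> None) =
      (full_cross p i S \<and> (\<forall>k\<in>{1..r}. second_diag n (delete_cross p i S) (j k) \<noteq> None))"
      by (simp add: i_def)
  qed
  also have "\<dots> = \<alpha> * \<beta> * wt_sum \<alpha> \<beta> n (\<lambda>S. \<forall>k\<in>{1..r}. second_diag n S (j k) \<noteq> None)"
    using wt_sum_full_cross[OF pi(1)] pi by simp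
  finally show ?thesis .
qed

text \<open>A deletion preserves the difference of size and number of boxes, so the earlier factors
  are those of the induction hypothesis. The last factor is \<alpha>\<beta> times the ratio of the
  partition functions of sizes \<open>n - 1\<close> and \<open>n\<close>.\<close>

lemma wt_sum_second_diag_ratio:
  assumes "\<alpha> > 0" "\<beta> > 0" "\<forall>k\<in>{1..r}. 1 \<le> j k \<and> j k + 1 \<le> n"
    and "\<forall>k\<in>{1..<r}. j k + 2 \<le> j (k + 1)"
  shows "wt_sum \<alpha> \<beta> n (\<lambda>S. \<forall>k\<in>{1..r}. second_diag n S (j k) \<noteq> None) / wt_sum \<alpha> \<beta> n (\<lambda>_. True) =
    (\<Prod>k=1..r. 1 / (real n + inverse \<alpha> + inverse \<beta> - real r + real k - 1))"
  using assms(3,4)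
proof (induction r arbitrary: n)
  case 0
  then show ?case using wt_sum_pos[OF assms(1,2), of n] by simp
next
  case (Suc r)
  obtain m where n: "n = Suc m"
    using Suc.prems(1) by (cases n) force+
  have last: "j k + 2 \<le> j (Suc r)" if "k \<in> {1..r}" for k
  proof -
    have "k \<le> r" "1 \<le> k" using that by auto
    then show ?thesis
    proof (induction rule: inc_induct)
      case base
      then show ?case using Suc.prems(2) by simp
    next
      case (step l)
      then have "j l + 2 \<le> j (l + 1)" using Suc.prems(2) by simp
      then show ?case using step by simp
    qed
  qed
  let ?W = "\<lambda>n r. wt_sum \<alpha> \<beta> n (\<lambda>S. \<forall>k\<in>{1..r}. second_diag n S (j k) \<noteq> None)"
  let ?Z = "\<lambda>n. wt_sum \<alpha> \<beta> n (\<lambda>_. True)"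
  have Z: "?Z m > 0" by (rule wt_sum_pos[OF assms(1,2)])
  \<comment> \<open>Together with \<open>last\<close> this keeps the remaining boxes within the
    second diagonal of size \<open>m\<close>.\<close>
  have "j (Suc r) \<le> m" using Suc.prems(1) n by simp
  then have IH: "?W m r / ?Z m = (\<Prod>k=1..r. 1 / (real m + inverse \<alpha> + inverse \<beta> - real r + real k - 1))"
    using Suc.prems last by (intro Suc.IH) force+
  have "?W n (Suc r) = \<alpha> * \<beta> * ?W m r"
    unfolding n by (rule wt_sum_second_diag) (use Suc.prems(1) last in \<open>auto simp: n\<close>)
  \<comment> \<open>Factoring \<alpha>\<beta> out of the recurrence brings in the inverses.\<close>
  moreover have "?Z n = \<alpha> * \<beta> * (real m + inverse \<alpha> + inverse \<beta>) * ?Z m"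
    unfolding n wt_sum_Suc using assms(1,2) by (simp add: field_simps)
  ultimately have "?W n (Suc r) / ?Z n = (?W m r / ?Z m) * (1 / (real m + inverse \<alpha> + inverse \<beta>))"
    using assms(1,2) by simp
  then show ?case
    unfolding IH by (simp add: n algebra_simps)
qed

theorem theorem5p1:
  fixes n r :: nat and \<alpha> \<beta> a b :: real and j :: "nat \<Rightarrow> nat"
  assumes "n \<ge> 2" and "\<alpha> > 0" and "\<beta> > 0"
    and "a = inverse \<alpha>" and "b = inverse \<beta>"
    and "\<forall>k\<in>{1..r}. 1 \<le> j k \<and> j k \<le> n - 1"
    and "strict_mono_on {1..r} j"
  shows "measure_pmf.prob (random_ab_tableau n \<alpha> \<beta>)
           {S. \<forall>k\<in>{1..r}. second_diag n S (j k) \<noteq> None} =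
         (if \<forall>k\<in>{1..<r}. j k + 2 \<le> j (k + 1)
          then \<Prod>k=1..r. 1 / (real n + a + b - real r + real k - 1)
          else 0)"
proof (cases "\<forall>k\<in>{1..<r}. j k + 2 \<le> j (k + 1)")
  case True
  have "\<forall>k\<in>{1..r}. 1 \<le> j k \<and> j k + 1 \<le> n"
    using assms(1,6) by force
  from wt_sum_second_diag_ratio[OF assms(2,3) this True] show ?thesis
    using True by (simp add: prob_random_ab_tableau[OF assms(2,3)] assms(4,5))
next
  case False
  then obtain k where k: "k \<in> {1..<r}" "j (k + 1) < j k + 2"
    by (auto simp: not_le)
  have "j k < j (k + 1)"
    using assms(7) k(1) by (auto simp: strict_mono_on_def)
  with k(2) have jk: "j (k + 1) = Suc (j k)" by simp
  define i where "i = j k"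
  define p where "p = n - Suc i"
  have pi: "p + Suc i = n"
    using assms(1,6) k(1) jk by (force simp: p_def i_def)
  have "\<not> (\<forall>k\<in>{1..r}. second_diag n S (j k) \<noteq> None)" if S: "S \<in> ab_tableaux n" for S
  proof
    assume *: "\<forall>k\<in>{1..r}. second_diag n S (j k) \<noteq> None"
    have "second_diag n S (j k) \<noteq> None" "second_diag n S (j (k + 1)) \<noteq> None"
      using * k(1) by auto
    then have "S (Suc p, i) \<noteq> None" "S (p, Suc i) \<noteq> None"
      using pi jk by (auto simp: second_diag_def p_def i_def Suc_diff_Suc)
    \<comment> \<open>Adjacent boxes share the diagonal neighbour \<open>(Suc p, Suc i)\<close>: the
      lower one forces an \<alpha> there, the upper one a \<beta>.\<close>
    then have "S (Suc p, Suc i) = Some Alpha" "S (Suc p, Suc i) = Some Beta"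
      using second_diag_nonempty[OF S, of "Suc p" i] second_diag_nonempty[OF S, of p "Suc i"] pi
      by auto
    then show False by simp
  qed
  then have "wt_sum \<alpha> \<beta> n (\<lambda>S. \<forall>k\<in>{1..r}. second_diag n S (j k) \<noteq> None) = 0"
    unfolding wt_sum_def by (intro sum.neutral) blast
  then show ?thesis
    unfolding prob_random_ab_tableau[OF assms(2,3)] if_not_P[OF False] by simp
qed

end
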